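(* Let $M$ be a monoid and $S$ a semiring. Then the following statements hold: (1) Each element of $\mathrm{Nil}(S)[M]$ is nilpotent in $S[M]$. (2) $\mathrm{Nil}(S[M]) = \mathrm{Nil}(S)[M]$ if one of the following conditions holds: (a) $S$ is a zerosumfree semiring; (b) $S$ is a weak Gaussian semiring and $M$ is a totally ordered monoid.
   Context: A semiring is a set $S$ with operations $+,\cdot$ such that $(S,+,0)$ and $(S,\cdot,1)$ are commutative monoids with $1\neq 0$, multiplication distributes over addition, and $s\cdot 0=0$ for all $s$. An ideal of $S$ is a nonempty subset closed under addition and under multiplication by elements of $S$. A proper ideal $\mathfrak p$ is prime if $ab\in\mathfrak p$ implies $a\in\mathfrak p$ or $b\in\mathfrak p$. An ideal $I$ is subtractive if $a+b\in I$ and $a\in I$ imply $b\in I$. $S$ is weak Gaussian if every prime ideal of $S$ is subtractive, and zerosumfree if $a+b=0$ implies $a=b=0$ for all $a,b\in S$. $\mathrm{Nil}(S)$ is the set of nilpotent elements of $S$. All monoids are commutative and written additively. $M$ is a totally ordered monoid if there is a total order $<$ on $M$ such that $a<b$ implies $a+c<b+c$ for all $a,b,c\in M$. $S[M]$ is the monoid semiring, whose elements are finite formal sums $\sum_i s_iX^{m_i}$ with $s_i\in S$, $m_i\in M$, and $X^mX^{m'}=X^{m+m'}$. $\mathrm{Nil}(S)[M] := \{\sum_{i=1}^{n} f_i X^{m_i}: f_i \in \mathrm{Nil}(S),\ m_i \in M,\ n\in \mathbb N\}\subseteq S[M]$. *)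

theory Defs
  imports "HOL-Library.Poly_Mapping"
begin

text \<open>
  Semirings (commutative, \<open>1 \<noteq> 0\<close>, \<open>0\<close> absorbing) are the types of class \<open>comm_semiring_1\<close>,
  commutative monoids the types of class \<open>comm_monoid_add\<close>, and the monoid semiring \<open>S[M]\<close> is
  \<open>'m \<Rightarrow>\<^sub>0 's\<close> with its convolution product; \<open>s X\<^sup>m\<close> is \<open>Poly_Mapping.single m s\<close>.
\<close>

definition semiring_ideal :: "'s::comm_semiring_1 set \<Rightarrow> bool" where
  "semiring_ideal I \<longleftrightarrow>
     I \<noteq> {} \<and> (\<forall>a\<in>I. \<forall>b\<in>I. a + b \<in> I) \<and> (\<forall>s. \<forall>a\<in>I. s * a \<in> I)"

definition semiring_prime_ideal :: "'s::comm_semiring_1 set \<Rightarrow> bool" where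
  "semiring_prime_ideal P \<longleftrightarrow>
     semiring_ideal P \<and> P \<noteq> UNIV \<and> (\<forall>a b. a * b \<in> P \<longrightarrow> a \<in> P \<or> b \<in> P)"

definition subtractive :: "'s::comm_semiring_1 set \<Rightarrow> bool" where
  "subtractive I \<longleftrightarrow> (\<forall>a b. a + b \<in> I \<and> a \<in> I \<longrightarrow> b \<in> I)"

definition weak_gaussian :: "'s::comm_semiring_1 itself \<Rightarrow> bool" where
  "weak_gaussian _ \<longleftrightarrow> (\<forall>P :: 's set. semiring_prime_ideal P \<longrightarrow> subtractive P)"

definition zerosumfree :: "'s::comm_semiring_1 itself \<Rightarrow> bool" where
  "zerosumfree _ \<longleftrightarrow> (\<forall>a b :: 's. a + b = 0 \<longrightarrow> a = 0 \<and> b = 0)"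

definition nilpotent :: "'s::comm_semiring_1 \<Rightarrow> bool" where
  "nilpotent a \<longleftrightarrow> (\<exists>n>0. a ^ n = 0)"

definition Nil_set :: "'s::comm_semiring_1 set" where
  "Nil_set = {a. nilpotent a}"

text \<open>
  The order is existentially quantified: the class \<open>comm_monoid_add\<close> carries no order.
\<close>

definition totally_ordered_monoid :: "'m::comm_monoid_add itself \<Rightarrow> bool" where
  "totally_ordered_monoid _ \<longleftrightarrow>
     (\<exists>(le :: 'm \<Rightarrow> 'm \<Rightarrow> bool) lt. class.linorder le lt \<and>
        (\<forall>a b c. lt a b \<longrightarrow> lt (a + c) (b + c)))"

text \<open>\<open>A[M]\<close> for a subset \<open>A\<close> of \<open>S\<close>; the exponents \<open>m i\<close> need not be distinct.\<close>

definition monoid_sums :: "'s::comm_semiring_1 set \<Rightarrow> ('m::comm_monoid_add \<Rightarrow>\<^sub>0 's) set" where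
  "monoid_sums A =
     {\<Sum>i=1..n. Poly_Mapping.single (m i) (f i) | (n::nat) f m. \<forall>i\<in>{1..n}. f i \<in> A}"

end

theory Submission
  imports Defs
begin

text \<open>
  Nilpotent elements form an ideal, and a monomial with nilpotent coefficient is nilpotent; this
  gives (1). For (2a), \<open>(s X\<^sup>m)\<^sup>n\<close> is a summand of \<open>f\<^sup>n = 0\<close> whenever \<open>s X\<^sup>m\<close> is a term of \<open>f\<close>, hence
  vanishes by zerosumfreeness. For (2b), let \<open>P\<close> be a prime, hence subtractive, ideal of \<open>S\<close>.
  Comparing the largest exponents with coefficient outside \<open>P\<close> shows that \<open>P[M]\<close> is prime, so it
  contains every nilpotent \<open>f\<close>. The coefficients of \<open>f\<close> therefore lie in all prime ideals of \<open>S\<close>,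
  and by Krull's argument (an ideal maximal among those avoiding the powers of \<open>s\<close> is prime)
  they are nilpotent.
\<close>

section \<open>Nilpotent elements and monomials: statement (1)\<close>

lemma nilpotent_zero: "nilpotent 0"
  unfolding nilpotent_def by (auto intro: exI[of _ 1])

text \<open>The binomial theorem needs no subtraction. In each term of exponent
  \<open>n + k\<close>, either \<open>a\<close> has exponent at least \<open>n\<close> or
  \<open>b\<close> has exponent at least \<open>k\<close>.\<close>

lemma nilpotent_add:
  fixes a b :: "'a::comm_semiring_1"
  assumes "nilpotent a" "nilpotent b"
  shows "nilpotent (a + b)"
proof -
  obtain n k where n: "n > 0" "a ^ n = 0" and k: "b ^ k = 0"
    using assms by (auto simp: nilpotent_def)
  have "of_nat ((n + k) choose i) * a ^ i * b ^ (n + k - i) = 0" for i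
  proof (cases "n \<le> i")
    case True
    then have "a ^ i = a ^ n * a ^ (i - n)" by (simp flip: power_add add: add.commute)
    with n show ?thesis by simp
  next
    case False
    then have "b ^ (n + k - i) = b ^ k * b ^ (n - i)" by (simp flip: power_add add: add.commute)
    with k show ?thesis by simp
  qed
  then have "(a + b) ^ (n + k) = 0" by (simp add: binomial_ring)
  with n show ?thesis unfolding nilpotent_def by (intro exI[of _ "n + k"]) auto
qed

lemma nilpotent_sum:
  fixes f :: "'b \<Rightarrow> 'a::comm_semiring_1"
  assumes "\<And>i. i \<in> A \<Longrightarrow> nilpotent (f i)"
  shows "nilpotent (sum f A)"
  using assms by (induction A rule: infinite_finite_induct)
    (auto simp: nilpotent_zero intro: nilpotent_add)

lemma single_power:
  fixes s :: "'s::comm_semiring_1" and m :: "'m::comm_monoid_add"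
  shows "Poly_Mapping.single m s ^ n = Poly_Mapping.single (\<Sum>i<n. m) (s ^ n)"
  by (induction n) (simp_all add: mult_single add.commute)

lemma nilpotent_single:
  fixes s :: "'s::comm_semiring_1" and m :: "'m::comm_monoid_add"
  assumes "nilpotent s"
  shows "nilpotent (Poly_Mapping.single m s)"
  using assms unfolding nilpotent_def single_power by (metis single_zero)

lemma nilpotent_monoid_sums:
  assumes "f \<in> monoid_sums Nil_set"
  shows "nilpotent f"
  using assms by (auto simp: monoid_sums_def Nil_set_def intro!: nilpotent_sum nilpotent_single)

section \<open>Elements and products of the monoid semiring through coefficients\<close>

lemma poly_mapping_eq_sum_single:
  fixes f :: "'m \<Rightarrow>\<^sub>0 's::comm_monoid_add"
  shows "f = (\<Sum>m\<in>Poly_Mapping.keys f. Poly_Mapping.single m (Poly_Mapping.lookup f m))"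
  by (rule poly_mapping_eqI)
    (auto simp: lookup_sum lookup_single when_def sum.delta in_keys_iff)

text \<open>Enumerating the finite support gives the indexed form that \<open>monoid_sums\<close>
  asks for.\<close>

lemma in_monoid_sumsI:
  fixes f :: "'m::comm_monoid_add \<Rightarrow>\<^sub>0 's::comm_semiring_1"
  assumes "\<And>m. Poly_Mapping.lookup f m \<in> A"
  shows "f \<in> monoid_sums A"
proof -
  obtain h where h: "bij_betw h {1..card (Poly_Mapping.keys f)} (Poly_Mapping.keys f)"
    using ex_bij_betw_nat_finite_1[OF finite_keys] by blast
  have "f = (\<Sum>i=1..card (Poly_Mapping.keys f). Poly_Mapping.single (h i) (Poly_Mapping.lookup f (h i)))"
    by (subst poly_mapping_eq_sum_single) (rule sum.reindex_bij_betw[OF h, symmetric])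
  with assms show ?thesis
    unfolding monoid_sums_def by (auto intro!: exI[of _ "\<lambda>i. Poly_Mapping.lookup f (h i)"] exI)
qed

text \<open>Writing the convolution as a finite sum over pairs lets a single pair of exponents be
  split off later.\<close>

lemma lookup_times_eq_sum:
  fixes f g :: "'m::comm_monoid_add \<Rightarrow>\<^sub>0 's::comm_semiring_1"
  shows "Poly_Mapping.lookup (f * g) k =
    (\<Sum>(a, b)\<in>Poly_Mapping.keys f \<times> Poly_Mapping.keys g. if a + b = k then Poly_Mapping.lookup f a * Poly_Mapping.lookup g b else 0)"
proof -
  have "f * g = (\<Sum>a\<in>Poly_Mapping.keys f. Poly_Mapping.single a (Poly_Mapping.lookup f a)) *
      (\<Sum>b\<in>Poly_Mapping.keys g. Poly_Mapping.single b (Poly_Mapping.lookup g b))"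
    using poly_mapping_eq_sum_single[of f] poly_mapping_eq_sum_single[of g] by simp
  also have "\<dots> = (\<Sum>(a, b)\<in>Poly_Mapping.keys f \<times> Poly_Mapping.keys g.
      Poly_Mapping.single (a + b) (Poly_Mapping.lookup f a * Poly_Mapping.lookup g b))"
    by (simp add: sum_product mult_single sum.cartesian_product)
  finally show ?thesis
    by (auto simp: lookup_sum lookup_single when_def intro!: sum.cong)
qed

section \<open>Zerosumfree coefficients\<close>

lemma add_power_summand:
  fixes a b :: "'a::comm_semiring_1"
  shows "\<exists>c. (a + b) ^ n = a ^ n + c"
proof (induction n)
  case (Suc n)
  then obtain c where "(a + b) ^ n = a ^ n + c" by blast
  then have "(a + b) ^ Suc n = a ^ Suc n + (a * c + b * (a ^ n + c))"
    by (simp add: algebra_simps)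
  then show ?case by blast
qed (auto intro: exI[of _ 0])

lemma zerosumfree_nilpotent_lookup:
  fixes f :: "'m::comm_monoid_add \<Rightarrow>\<^sub>0 's::comm_semiring_1"
  assumes zsf: "zerosumfree TYPE('s)" and f: "nilpotent f"
  shows "nilpotent (Poly_Mapping.lookup f m)"
proof (cases "m \<in> Poly_Mapping.keys f")
  case False
  then show ?thesis by (simp add: in_keys_iff nilpotent_zero)
next
  case True
  let ?t = "Poly_Mapping.single m (Poly_Mapping.lookup f m)"
  obtain n where n: "n > 0" "f ^ n = 0" using f by (auto simp: nilpotent_def)
  have "\<exists>g. f = ?t + g"
    using poly_mapping_eq_sum_single[of f] sum.remove[OF finite_keys True] by metis
  then obtain c where "f ^ n = ?t ^ n + c" using add_power_summand by metis
  \<comment> \<open>Zerosumfreeness is given for the coefficients only, so the equation is read one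
    exponent at a time.\<close>
  then have "Poly_Mapping.lookup (?t ^ n) k + Poly_Mapping.lookup c k = 0" for k using n by (metis lookup_add lookup_zero)
  then have "Poly_Mapping.lookup (?t ^ n) k = 0" for k using zsf unfolding zerosumfree_def by blast
  then have "Poly_Mapping.lookup f m ^ n = 0" unfolding single_power by (metis lookup_single_eq)
  with n show ?thesis unfolding nilpotent_def by blast
qed

section \<open>Ideals and Krull's argument\<close>

lemma semiring_ideal_zero: "semiring_ideal I \<Longrightarrow> 0 \<in> I"
  unfolding semiring_ideal_def by (metis all_not_in_conv mult_zero_left)

lemma semiring_ideal_sum:
  assumes "semiring_ideal I" "\<And>i. i \<in> A \<Longrightarrow> f i \<in> I"
  shows "sum f A \<in> I"
  using assms(2) by (induction A rule: infinite_finite_induct)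
    (use assms(1) in \<open>auto simp: semiring_ideal_zero semiring_ideal_def\<close>)

lemma semiring_prime_ideal_one: "semiring_prime_ideal P \<Longrightarrow> 1 \<notin> P"
  unfolding semiring_prime_ideal_def semiring_ideal_def by (metis UNIV_eq_I mult.right_neutral)

text \<open>\<open>J\<close> is the ideal generated by \<open>I\<close> and \<open>a\<close>; it
  serves to enlarge a maximal ideal.\<close>

lemma semiring_ideal_adjoin:
  fixes a :: "'s::comm_semiring_1"
  assumes I: "semiring_ideal I"
  defines "J \<equiv> {x + r * a | x r. x \<in> I}"
  shows "semiring_ideal J" "I \<subseteq> J" "a \<in> J"
proof -
  have add: "u + v \<in> J" if uv: "u \<in> J" "v \<in> J" for u v
  proof -
    obtain x r y q where "x \<in> I" "y \<in> I" "u = x + r * a" "v = y + q * a"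
      using uv unfolding J_def by blast
    moreover from this have "u + v = (x + y) + (r + q) * a" by (simp add: algebra_simps)
    moreover have "x + y \<in> I" using calculation I by (simp add: semiring_ideal_def)
    ultimately show ?thesis unfolding J_def by blast
  qed
  have mult: "t * u \<in> J" if u: "u \<in> J" for t u
  proof -
    obtain x r where "x \<in> I" "u = x + r * a" using u unfolding J_def by blast
    moreover from this have "t * u = t * x + (t * r) * a" by (simp add: algebra_simps)
    moreover have "t * x \<in> I" using calculation I by (simp add: semiring_ideal_def)
    ultimately show ?thesis unfolding J_def by blast
  qed
  have "0 + 1 * a \<in> J" unfolding J_def using semiring_ideal_zero[OF I] by blast
  then show "a \<in> J" by simp
  with add mult show "semiring_ideal J" unfolding semiring_ideal_def by blast
  have "x + 0 * a \<in> J" if "x \<in> I" for x unfolding J_def using that by blast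
  then show "I \<subseteq> J" by auto
qed

text \<open>If \<open>a\<close> and \<open>b\<close> lie outside \<open>P\<close>, adjoining either
  one captures a power of \<open>s\<close>. The product of these two powers would lie in
  \<open>P\<close> as soon as \<open>a * b\<close> does.\<close>

lemma maximal_avoiding_powers_prime:
  fixes s :: "'s::comm_semiring_1"
  assumes P: "semiring_ideal P" and avoid: "\<And>n. s ^ n \<notin> P"
    and maximal: "\<And>J. semiring_ideal J \<Longrightarrow> \<forall>n. s ^ n \<notin> J \<Longrightarrow> P \<subseteq> J \<Longrightarrow> J = P"
  shows "semiring_prime_ideal P"
proof -
  have meets: "\<exists>n x r. x \<in> P \<and> s ^ n = x + r * a" if "a \<notin> P" for a
    using maximal[OF semiring_ideal_adjoin(1)[OF P, of a]]
      semiring_ideal_adjoin(2,3)[OF P, of a] that by auto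
  have "a \<in> P \<or> b \<in> P" if ab: "a * b \<in> P" for a b
  proof (rule ccontr)
    assume "\<not> (a \<in> P \<or> b \<in> P)"
    then obtain n x r k y q where x: "x \<in> P" "s ^ n = x + r * a"
      and y: "y \<in> P" "s ^ k = y + q * b"
      using meets[of a] meets[of b] by blast
    have "s ^ (n + k) = (y + q * b) * x + ((r * a) * y + (r * q) * (a * b))"
      unfolding power_add x(2) y(2) by (simp add: algebra_simps)
    also have "\<dots> \<in> P" using P x(1) y(1) ab unfolding semiring_ideal_def by blast
    finally show False using avoid by blast
  qed
  \<comment> \<open>The power \<open>s ^ 0 = 1\<close> is avoided too, so \<open>P\<close> is
    proper.\<close>
  with P avoid[of 0] show ?thesis unfolding semiring_prime_ideal_def by auto
qed

lemma nilpotent_if_in_all_primes: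
  fixes s :: "'s::comm_semiring_1"
  assumes "\<And>P. semiring_prime_ideal P \<Longrightarrow> s \<in> P"
  shows "nilpotent s"
proof (rule ccontr)
  assume not_nil: "\<not> nilpotent s"
  define F where "F = {I. semiring_ideal I \<and> (\<forall>n. s ^ n \<notin> I)}"
  \<comment> \<open>The case \<open>n = 0\<close>, which \<open>nilpotent\<close> excludes, is
    \<open>1 \<noteq> 0\<close>.\<close>
  have "s ^ n \<noteq> 0" for n using not_nil unfolding nilpotent_def by (cases n) auto
  then have "{0} \<in> F" unfolding F_def semiring_ideal_def by auto
  moreover have "\<Union>C \<in> F" if C: "C \<noteq> {}" "subset.chain F C" for C
  proof -
    have CF: "C \<subseteq> F" and chain: "\<And>I J. I \<in> C \<Longrightarrow> J \<in> C \<Longrightarrow> I \<subseteq> J \<or> J \<subseteq> I"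
      using C(2) unfolding subset_chain_def by auto
    have ideal: "semiring_ideal I" if "I \<in> C" for I using that CF unfolding F_def by auto
    have "a + b \<in> \<Union>C" if ab: "a \<in> \<Union>C" "b \<in> \<Union>C" for a b
    proof -
      \<comment> \<open>The larger of the two chain members containing \<open>a\<close> and
        \<open>b\<close>.\<close>
      obtain I where "I \<in> C" "a \<in> I" "b \<in> I" using ab chain by blast
      with ideal show ?thesis unfolding semiring_ideal_def by blast
    qed
    moreover have "t * a \<in> \<Union>C" if "a \<in> \<Union>C" for t a
      using that ideal unfolding semiring_ideal_def by blast
    moreover have "\<Union>C \<noteq> {}" using C(1) semiring_ideal_zero[OF ideal] by blast
    ultimately have "semiring_ideal (\<Union>C)" unfolding semiring_ideal_def by blast
    with CF show ?thesis unfolding F_def by blast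
  qed
  ultimately obtain P where P: "P \<in> F" "\<forall>X\<in>F. P \<subseteq> X \<longrightarrow> X = P"
    using subset_Zorn_nonempty[of F] by blast
  then have "semiring_prime_ideal P"
    by (intro maximal_avoiding_powers_prime[of P s]) (auto simp: F_def)
  with assms have "s ^ 1 \<in> P" by simp
  with P(1) show False unfolding F_def by blast
qed

section \<open>Weak Gaussian coefficients and ordered exponents\<close>

lemma linorder_add_eq_imp_less:
  fixes m k a b :: "'m::comm_monoid_add"
  assumes "class.linorder le lt" and mono: "\<And>a b c. lt a b \<Longrightarrow> lt (a + c) (b + c)"
    and eq: "a + b = m + k" and ne: "(a, b) \<noteq> (m, k)"
  shows "lt m a \<or> lt k b"
proof (rule ccontr)
  interpret ord: linorder le lt by fact
  assume "\<not> (lt m a \<or> lt k b)"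
  then have "le a m" "le b k" by (auto simp: ord.not_less)
  \<comment> \<open>One of the two inequalities is strict because the pairs differ, and adding them
    keeps strictness.\<close>
  then have "lt (a + b) (m + k)"
    using ne mono[of a m b] mono[of b k m] mono[of b k a]
    by (metis add.commute ord.le_less ord.less_trans)
  with eq show False by simp
qed

text \<open>A form of Gauss's lemma. If \<open>m\<close> and \<open>k\<close> are the largest
  exponents with coefficients outside \<open>P\<close>, all other contributions to the coefficient
  of the product at \<open>m + k\<close> lie in \<open>P\<close>. Subtractivity leaves the product
  of the two chosen coefficients in \<open>P\<close>, against primality.\<close>

lemma coefficients_in_prime_mult:
  fixes f g :: "'m::comm_monoid_add \<Rightarrow>\<^sub>0 's::comm_semiring_1"
  assumes M: "totally_ordered_monoid TYPE('m)"
    and P: "semiring_prime_ideal P" and sub: "subtractive P"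
    and fg: "\<And>k. Poly_Mapping.lookup (f * g) k \<in> P"
  shows "(\<forall>k. Poly_Mapping.lookup f k \<in> P) \<or> (\<forall>k. Poly_Mapping.lookup g k \<in> P)"
proof (rule ccontr)
  assume contra: "\<not> ?thesis"
  obtain le lt :: "'m \<Rightarrow> 'm \<Rightarrow> bool" where lin: "class.linorder le lt"
    and mono: "\<And>a b c. lt a b \<Longrightarrow> lt (a + c) (b + c)"
    using M unfolding totally_ordered_monoid_def by blast
  interpret ord: linorder le lt by (rule lin)
  have I: "semiring_ideal P" using P unfolding semiring_prime_ideal_def by blast
  have largest: "\<exists>m. Poly_Mapping.lookup h m \<notin> P \<and> (\<forall>k. lt m k \<longrightarrow> Poly_Mapping.lookup h k \<in> P)"
    if "\<not> (\<forall>k. Poly_Mapping.lookup h k \<in> P)" for h :: "'m \<Rightarrow>\<^sub>0 's"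
  proof -
    let ?A = "{k. Poly_Mapping.lookup h k \<notin> P}"
    \<comment> \<open>As \<open>0 \<in> P\<close>, exponents outside the support do not count, so a
      maximum exists.\<close>
    have "?A \<subseteq> Poly_Mapping.keys h" using semiring_ideal_zero[OF I] by (auto simp: in_keys_iff)
    then have "finite ?A" by (rule finite_subset) simp
    moreover have "?A \<noteq> {}" using that by blast
    ultimately obtain m where "m \<in> ?A" "\<forall>k\<in>?A. le m k \<longrightarrow> m = k"
      using ord.finite_has_maximal by meson
    then show ?thesis using ord.less_le by blast
  qed
  obtain m k where m: "Poly_Mapping.lookup f m \<notin> P" "\<And>a. lt m a \<Longrightarrow> Poly_Mapping.lookup f a \<in> P"
    and k: "Poly_Mapping.lookup g k \<notin> P" "\<And>b. lt k b \<Longrightarrow> Poly_Mapping.lookup g b \<in> P"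
    using contra largest[of f] largest[of g] by blast
  define t where
    "t = (\<lambda>(a, b). if a + b = m + k then Poly_Mapping.lookup f a * Poly_Mapping.lookup g b else 0)"
  let ?K = "Poly_Mapping.keys f \<times> Poly_Mapping.keys g"
  have mk: "(m, k) \<in> ?K" using m(1) k(1) semiring_ideal_zero[OF I] by (auto simp: in_keys_iff)
  have "t (a, b) \<in> P" if ne: "(a, b) \<noteq> (m, k)" for a b
  proof (cases "a + b = m + k")
    case True
    then have "Poly_Mapping.lookup f a \<in> P \<or> Poly_Mapping.lookup g b \<in> P"
      using linorder_add_eq_imp_less[OF lin mono True ne] m(2) k(2) by blast
    then have "Poly_Mapping.lookup f a * Poly_Mapping.lookup g b \<in> P"
      using I unfolding semiring_ideal_def by (metis mult.commute)
    with True show ?thesis by (simp add: t_def)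
  qed (simp add: t_def semiring_ideal_zero[OF I])
  then have rest: "sum t (?K - {(m, k)}) \<in> P" by (intro semiring_ideal_sum[OF I]) auto
  have "Poly_Mapping.lookup (f * g) (m + k) = sum t ?K" unfolding lookup_times_eq_sum t_def ..
  also have "\<dots> = t (m, k) + sum t (?K - {(m, k)})" using mk by (intro sum.remove) auto
  finally have "sum t (?K - {(m, k)}) + t (m, k) \<in> P" using fg[of "m + k"] by (simp add: add.commute)
  with rest sub have "t (m, k) \<in> P" unfolding subtractive_def by blast
  then have "Poly_Mapping.lookup f m * Poly_Mapping.lookup g k \<in> P" by (simp add: t_def)
  with P m(1) k(1) show False unfolding semiring_prime_ideal_def by blast
qed

lemma weak_gaussian_nilpotent_lookup:
  fixes f :: "'m::comm_monoid_add \<Rightarrow>\<^sub>0 's::comm_semiring_1"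
  assumes S: "weak_gaussian TYPE('s)" and M: "totally_ordered_monoid TYPE('m)"
    and f: "nilpotent f"
  shows "nilpotent (Poly_Mapping.lookup f m)"
proof (rule nilpotent_if_in_all_primes)
  fix P :: "'s set"
  assume P: "semiring_prime_ideal P"
  with S have sub: "subtractive P" unfolding weak_gaussian_def by blast
  \<comment> \<open>Primality of the coefficient condition passes from products to powers. For
    \<open>n = 0\<close> the premise fails, since \<open>1\<close> has coefficient \<open>1\<close>
    at exponent \<open>0\<close>.\<close>
  have power: "\<forall>k. Poly_Mapping.lookup f k \<in> P" if "\<forall>k. Poly_Mapping.lookup (f ^ n) k \<in> P" for n
    using that
  proof (induction n)
    case 0
    then have "(1::'s) \<in> P" by (metis lookup_one_zero power_0)
    with semiring_prime_ideal_one[OF P] show ?case by blast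
  next
    case (Suc n)
    then show ?case using coefficients_in_prime_mult[OF M P sub, of f "f ^ n"] by auto
  qed
  obtain n where "f ^ n = 0" using f by (auto simp: nilpotent_def)
  then show "Poly_Mapping.lookup f m \<in> P"
    using power[of n] P by (simp add: semiring_ideal_zero semiring_prime_ideal_def)
qed

theorem theorem5p6:
  shows "(\<forall>f \<in> (monoid_sums Nil_set :: ('m::comm_monoid_add \<Rightarrow>\<^sub>0 's::comm_semiring_1) set). nilpotent f) \<and>
    (zerosumfree TYPE('s) \<or> (weak_gaussian TYPE('s) \<and> totally_ordered_monoid TYPE('m)) \<longrightarrow>
       (Nil_set :: ('m \<Rightarrow>\<^sub>0 's) set) = monoid_sums (Nil_set :: 's set))"
proof (intro conjI impI ballI)
  show "nilpotent f" if "f \<in> monoid_sums Nil_set" for f :: "'m \<Rightarrow>\<^sub>0 's"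
    using that by (rule nilpotent_monoid_sums)
  assume "zerosumfree TYPE('s) \<or> (weak_gaussian TYPE('s) \<and> totally_ordered_monoid TYPE('m))"
  \<comment> \<open>Both cases of (2) reduce to nilpotency of the coefficients; the other inclusion
    is (1).\<close>
  then have "nilpotent (Poly_Mapping.lookup f m)" if "nilpotent f" for f :: "'m \<Rightarrow>\<^sub>0 's" and m
    using that zerosumfree_nilpotent_lookup weak_gaussian_nilpotent_lookup by blast
  then show "(Nil_set :: ('m \<Rightarrow>\<^sub>0 's) set) = monoid_sums (Nil_set :: 's set)"
    by (auto simp: Nil_set_def intro: in_monoid_sumsI
        nilpotent_monoid_sums[unfolded Nil_set_def])
qed

end
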